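(* Let $S=\bigcup_{j=1}^\infty[\gamma_j,\gamma_j+1]=\Gamma+[0,1]$, where $\Gamma=\{\gamma_j:j\in\mathbb{N}\}\subset\mathbb{R}$ and $\xi_j:=\gamma_{j+1}-\gamma_j-1\in[2,3]$ for all $j\in\mathbb{N}$. Assume that $\Gamma$ satisfies property (C). Then for every $\alpha>1/2$, no uniformly discrete set $\Lambda\subset\mathbb{R}$ is a uniqueness set for $W^{(\alpha)}_S$.
   Context: Property (C) of a set $\Gamma$: for every $m\in\mathbb{N}$ there are rationally independent numbers $q_1,\dots,q_m$ such that for every $N\in\mathbb{N}$ there exist $a_1,\dots,a_m$ with $\bigcup_{j=1}^m\{a_j+q_j,a_j+2q_j,\dots,a_j+Nq_j\}\subset\Gamma$. Fourier transform: $\hat f(t)=\int e^{-2\pi i t x}f(x)\,dx$. For $\alpha>1/2$, $W^{(\alpha)}_S$ is the space of functions $f$ whose Fourier transform $F=\hat f$ satisfies $\int_{\mathbb{R}}(1+|t|^{2\alpha})|F(t)|^2\,dt<\infty$ and $F=0$ a.e. outside $S$ (such $f$ are continuous). A set $\Lambda$ is uniformly discrete if $\inf\{|\lambda-\lambda'|:\lambda\neq\lambda'\in\Lambda\}>0$. $\Lambda$ is a uniqueness set for a space of continuous functions if the only function in it vanishing on $\Lambda$ is zero. *)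

theory Defs
  imports "HOL-Analysis.Analysis"
begin

definition rationally_independent :: "nat \<Rightarrow> (nat \<Rightarrow> real) \<Rightarrow> bool" where
  "rationally_independent m q \<longleftrightarrow>
     (\<forall>r::nat \<Rightarrow> real. (\<forall>j<m. r j \<in> \<rat>) \<and> (\<Sum>j<m. r j * q j) = 0 \<longrightarrow> (\<forall>j<m. r j = 0))"

definition property_C :: "real set \<Rightarrow> bool" where
  "property_C \<Gamma> \<longleftrightarrow>
     (\<forall>m::nat. \<exists>q::nat \<Rightarrow> real. rationally_independent m q \<and>
        (\<forall>N::nat. \<exists>a::nat \<Rightarrow> real.
            (\<Union>j<m. {a j + real k * q j | k. k \<in> {1..N}}) \<subseteq> \<Gamma>))"

definition W_space :: "real \<Rightarrow> real set \<Rightarrow> (real \<Rightarrow> complex) set" where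
  "W_space \<alpha> S = {f. \<exists>F::real \<Rightarrow> complex.
      F \<in> borel_measurable lborel \<and>
      integrable lborel (\<lambda>t. (1 + \<bar>t\<bar> powr (2 * \<alpha>)) * (cmod (F t))\<^sup>2) \<and>
      (AE t in lborel. t \<notin> S \<longrightarrow> F t = 0) \<and>
      (\<forall>x. f x = (LINT t|lborel. F t * exp (2 * pi * \<i> * complex_of_real (t * x))))}"

definition uniformly_discrete :: "real set \<Rightarrow> bool" where
  "uniformly_discrete \<Lambda> \<longleftrightarrow>
     (\<exists>\<delta>>0. \<forall>x\<in>\<Lambda>. \<forall>y\<in>\<Lambda>. x \<noteq> y \<longrightarrow> \<delta> \<le> \<bar>x - y\<bar>)"

definition uniqueness_set :: "real set \<Rightarrow> (real \<Rightarrow> complex) set \<Rightarrow> bool" where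
  "uniqueness_set \<Lambda> V \<longleftrightarrow> (\<forall>f\<in>V. (\<forall>x\<in>\<Lambda>. f x = 0) \<longrightarrow> f = (\<lambda>_. 0))"

end

theory Submission
  imports Defs
begin

text \<open>
  Let \<open>\<Lambda>\<close> be \<open>\<delta>\<close>-separated. For every \<open>\<mu> \<in> \<Lambda>\<close> there is a function \<open>f\<^sub>\<mu>\<close> with \<open>f\<^sub>\<mu>(\<mu>) = 1\<close> and
  \<open>\<Sum>|f\<^sub>\<mu>(\<lambda>)| \<le> 1/2\<close> over the other points \<open>\<lambda>\<close>, whose spectrum lies in a bounded subset of \<open>S\<close> that
  depends on \<open>\<delta>\<close> only. Take a function \<open>h\<close> with spectrum in \<open>[0,1]\<close>, \<open>h(0) = 1\<close> and quadratic
  decay; it is small in the \<open>l\<^sup>1\<close> sense on the points of \<open>\<Lambda> - \<mu>\<close> outside some \<open>[-R,R]\<close>, and fewer than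
  \<open>m\<close> points lie inside. Apply property (C) with this \<open>m\<close>. By rational independence a nonzero point
  is near at most one of the lattices \<open>\<int>/q\<^sub>j\<close>, so by pigeonhole some lattice is avoided by all nonzero
  points of \<open>\<Lambda> - \<mu>\<close> in \<open>[-R,R]\<close>. Multiplying \<open>h\<close> by the mean of the exponentials with frequencies
  \<open>a\<^sub>j + k q\<^sub>j\<close>, \<open>1 \<le> k \<le> N\<close>, makes it small off that lattice.

  Hence the map sending coefficients \<open>c \<in> l\<^sup>1(\<Lambda>)\<close> to the restriction of \<open>\<Sum> c\<^sub>\<mu> f\<^sub>\<mu>\<close> to \<open>\<Lambda>\<close> is within
  \<open>1/2\<close> of the identity, and all \<open>l\<^sup>1\<close> data on \<open>\<Lambda>\<close> can be interpolated. Interpolating the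
  indicator of an extra point \<open>x\<^sub>0\<close> on \<open>\<Lambda> \<union> {x\<^sub>0}\<close> gives a nonzero function vanishing on \<open>\<Lambda>\<close>.
\<close>

section \<open>Characters of the real line\<close>

definition unit_char :: "real \<Rightarrow> complex" where
  "unit_char x = exp (2 * pi * \<i> * complex_of_real x)"

lemma unit_char_eq_cis: "unit_char x = cis (2 * pi * x)"
  by (simp add: unit_char_def cis_conv_exp mult_ac)

lemma unit_char_0 [simp]: "unit_char 0 = 1"
  by (simp add: unit_char_def)

lemma unit_char_add: "unit_char (x + y) = unit_char x * unit_char y"
  by (simp add: unit_char_def exp_add ring_distribs)

lemma norm_unit_char [simp]: "norm (unit_char x) = 1"
  by (simp add: unit_char_eq_cis)

lemma unit_char_eq_1_iff: "unit_char x = 1 \<longleftrightarrow> x \<in> \<int>"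
proof -
  have "unit_char x = 1 \<longleftrightarrow> (\<exists>n::int. 2 * pi * x = of_int (2 * n) * pi)"
    by (simp add: unit_char_def exp_eq_1)
  also have "\<dots> \<longleftrightarrow> (\<exists>n::int. x = of_int n)"
    by (simp add: field_simps)
  finally show ?thesis by (auto simp: Ints_def)
qed

lemma continuous_on_unit_char [continuous_intros]:
  "continuous_on A g \<Longrightarrow> continuous_on A (\<lambda>x. unit_char (g x))"
  unfolding unit_char_def by (intro continuous_intros)

lemma unit_char_measurable [measurable]: "unit_char \<in> borel_measurable borel"
  by (intro borel_measurable_continuous_onI continuous_intros)

section \<open>Functions with bounded spectral density\<close>

text \<open>\<open>K\<close> confines the spectrum and \<open>C\<close> bounds the density
  pointwise. Sup bounds add under superposition, so series are easy to control, and for bounded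
  \<open>K\<close> they imply the weighted square integrability for every exponent
  \<open>\<alpha> \<ge> 0\<close>. The density itself stays hidden.\<close>

definition spectral_rep :: "real set \<Rightarrow> real \<Rightarrow> (real \<Rightarrow> complex) \<Rightarrow> bool" where
  "spectral_rep K C f \<longleftrightarrow> (\<exists>F. F \<in> borel_measurable lborel \<and> (\<forall>t. norm (F t) \<le> C) \<and>
     (\<forall>t. t \<notin> K \<longrightarrow> F t = 0) \<and> (\<forall>x. f x = (LINT t|lborel. F t * unit_char (t * x))))"

lemma integrable_bounded_support:
  fixes F :: "real \<Rightarrow> 'a :: {banach, second_countable_topology}"
  assumes "F \<in> borel_measurable lborel" "\<And>t. norm (F t) \<le> C" "\<And>t. t \<notin> {-L..L} \<Longrightarrow> F t = 0"
  shows "integrable lborel F"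
proof (rule Bochner_Integration.integrable_bound)
  show "integrable lborel (\<lambda>t. C * indicator {-L..L} t :: real)"
    by (cases "-L \<le> L") auto
  show "AE t in lborel. norm (F t) \<le> norm (C * indicator {-L..L} t)"
    using assms(2,3) by (intro AE_I2) (auto simp: indicator_def intro: order_trans[OF _ abs_ge_self])
qed (use assms in auto)

lemma bounded_subset_symmetric_interval:
  fixes K :: "real set" assumes "bounded K"
  obtains L where "K \<subseteq> {-L..L}"
  using assms unfolding bounded_real by (meson abs_le_iff atLeastAtMost_iff minus_le_iff subsetI)

lemma spectral_integrable:
  assumes "bounded K" "F \<in> borel_measurable lborel" "\<And>t. norm (F t) \<le> C" "\<And>t. t \<notin> K \<Longrightarrow> F t = 0"
  shows "integrable lborel (\<lambda>t. F t * unit_char (t * x))"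
proof -
  obtain L where "K \<subseteq> {-L..L}" using bounded_subset_symmetric_interval assms(1) by blast
  then show ?thesis
    using assms by (intro integrable_bounded_support[where C = C and L = L]) (auto simp: norm_mult subset_iff)
qed

lemma spectral_rep_scale:
  assumes "spectral_rep K C f" shows "spectral_rep K (norm c * C) (\<lambda>x. c * f x)"
proof -
  obtain F where F: "F \<in> borel_measurable lborel" "\<And>t. norm (F t) \<le> C" "\<And>t. t \<notin> K \<Longrightarrow> F t = 0"
    "\<And>x. f x = (LINT t|lborel. F t * unit_char (t * x))"
    using assms unfolding spectral_rep_def by blast
  show ?thesis unfolding spectral_rep_def
    by (rule exI[of _ "\<lambda>t. c * F t"])
       (use F in \<open>auto simp: norm_mult mult.assoc intro: mult_left_mono\<close>)
qed

lemma spectral_rep_mono: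
  assumes "spectral_rep K C f" "C \<le> C'" "K \<subseteq> K'" shows "spectral_rep K' C' f"
  using assms unfolding spectral_rep_def by (meson order_trans subset_iff)

lemma spectral_rep_add:
  assumes "bounded K" "spectral_rep K C f" "spectral_rep K D g"
  shows "spectral_rep K (C + D) (\<lambda>x. f x + g x)"
proof -
  obtain F where F: "F \<in> borel_measurable lborel" "\<And>t. norm (F t) \<le> C" "\<And>t. t \<notin> K \<Longrightarrow> F t = 0"
    "\<And>x. f x = (LINT t|lborel. F t * unit_char (t * x))"
    using assms(2) unfolding spectral_rep_def by blast
  obtain G where G: "G \<in> borel_measurable lborel" "\<And>t. norm (G t) \<le> D" "\<And>t. t \<notin> K \<Longrightarrow> G t = 0"
    "\<And>x. g x = (LINT t|lborel. G t * unit_char (t * x))"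
    using assms(3) unfolding spectral_rep_def by blast
  have "f x + g x = (LINT t|lborel. (F t + G t) * unit_char (t * x))" for x
    unfolding F(4) G(4) ring_distribs
    using spectral_integrable[OF assms(1) F(1-3)] spectral_integrable[OF assms(1) G(1-3)]
    by (subst Bochner_Integration.integral_add) auto
  then show ?thesis unfolding spectral_rep_def
    by (intro exI[of _ "\<lambda>t. F t + G t"])
       (use F G in \<open>auto intro!: norm_triangle_le add_mono\<close>)
qed

lemma spectral_rep_sum:
  assumes "bounded K" "finite A" "\<And>i. i \<in> A \<Longrightarrow> spectral_rep K (C i) (f i)"
  shows "spectral_rep K (\<Sum>i\<in>A. C i) (\<lambda>x. \<Sum>i\<in>A. f i x)"
  using assms(2,3)
proof (induction A rule: finite_induct)
  case empty
  then show ?case unfolding spectral_rep_def by (intro exI[of _ "\<lambda>_. 0"]) auto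
next
  case (insert i A)
  then show ?case using spectral_rep_add[OF assms(1)] by simp
qed

text \<open>The densities are dominated by \<open>C k\<close> on one bounded interval, so their
  integrals are absolutely summable and the series may be exchanged with the integral. The new
  density is the pointwise sum.\<close>

lemma spectral_rep_suminf:
  assumes K: "bounded K" and f: "\<And>k. spectral_rep K (C k) (f k)" and C: "summable C"
  shows "spectral_rep K (suminf C) (\<lambda>x. \<Sum>k. f k x)"
proof -
  obtain F where F: "\<And>k. F k \<in> borel_measurable lborel" "\<And>k t. norm (F k t) \<le> C k"
    "\<And>k t. t \<notin> K \<Longrightarrow> F k t = 0" "\<And>k x. f k x = (LINT t|lborel. F k t * unit_char (t * x))"
    using f unfolding spectral_rep_def by metis
  obtain L where L: "K \<subseteq> {-L..L}" using bounded_subset_symmetric_interval K by blast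
  have F_summable: "summable (\<lambda>k. norm (F k t))" for t
    by (rule summable_comparison_test'[OF C, of 0]) (use F(2) in auto)
  have int: "integrable lborel (\<lambda>t. F k t * unit_char (t * x))" for k x
    by (rule spectral_integrable[OF K F(1-3)])
  have C0: "0 \<le> C k" for k using F(2)[of k 0] norm_ge_zero order_trans by blast
  \<comment> \<open>\<open>L\<close> may be negative if \<open>K\<close> is empty; with
    \<open>\<bar>L\<bar>\<close> the interval has length \<open>2 * \<bar>L\<bar>\<close> in every
    case.\<close>
  have norm_bound: "(LINT t|lborel. norm (F k t * unit_char (t * x))) \<le> C k * (2 * \<bar>L\<bar>)" for k x
  proof -
    have "(LINT t|lborel. norm (F k t * unit_char (t * x))) \<le> (LINT t|lborel. C k * indicator {-\<bar>L\<bar>..\<bar>L\<bar>} t)"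
    proof (rule integral_mono)
      fix t show "norm (F k t * unit_char (t * x)) \<le> C k * indicator {- \<bar>L\<bar>..\<bar>L\<bar>} t"
        using F(2)[of k t] F(3)[of t k] L C0[of k] by (cases "t \<in> K") (force simp: norm_mult indicator_def)+
    qed (use int in auto)
    then show ?thesis by simp
  qed
  have sum_int: "summable (\<lambda>k. LINT t|lborel. norm (F k t * unit_char (t * x)))" for x
    by (rule summable_comparison_test'[OF summable_mult2[OF C], of 0 _ "2 * \<bar>L\<bar>"])
       (use norm_bound in \<open>auto intro!: Bochner_Integration.integral_nonneg simp: abs_of_nonneg\<close>)
  have AE_sum: "AE t in lborel. summable (\<lambda>k. norm (F k t * unit_char (t * x)))" for x
    using F_summable by (simp add: norm_mult)
  have eq: "(\<Sum>k. f k x) = (LINT t|lborel. (\<Sum>k. F k t) * unit_char (t * x))" for x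
    using integral_suminf[OF int AE_sum sum_int] F(4)
    by (simp add: suminf_mult2[OF summable_norm_cancel[OF F_summable]])
  show "spectral_rep K (suminf C) (\<lambda>x. \<Sum>k. f k x)"
    unfolding spectral_rep_def
  proof (intro exI[of _ "\<lambda>t. \<Sum>k. F k t"] conjI allI impI)
    show "(\<lambda>t. \<Sum>k. F k t) \<in> borel_measurable lborel"
      using F(1) by measurable
    show "norm (\<Sum>k. F k t) \<le> suminf C" for t
      using F(2) by (intro order_trans[OF summable_norm[OF F_summable] suminf_le] F_summable C) auto
  qed (use eq F(3) in auto)
qed

text \<open>On a bounded set the weight \<open>1 + \<bar>t\<bar> powr (2 * \<alpha>)\<close> is
  bounded, so a bounded density has finite weighted norm.\<close>

lemma spectral_rep_in_W_space:
  assumes "bounded K" "K \<subseteq> S" "spectral_rep K C f" "\<alpha> \<ge> 0"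
  shows "f \<in> W_space \<alpha> S"
proof -
  obtain F where F: "F \<in> borel_measurable lborel" "\<And>t. norm (F t) \<le> C" "\<And>t. t \<notin> K \<Longrightarrow> F t = 0"
    "\<And>x. f x = (LINT t|lborel. F t * unit_char (t * x))"
    using assms(3) unfolding spectral_rep_def by blast
  obtain L where L: "K \<subseteq> {-L..L}" using bounded_subset_symmetric_interval assms(1) by blast
  have "integrable lborel (\<lambda>t. (1 + \<bar>t\<bar> powr (2 * \<alpha>)) * (cmod (F t))\<^sup>2)"
  proof (rule integrable_bounded_support[where L = L])
    show "(\<lambda>t. (1 + \<bar>t\<bar> powr (2 * \<alpha>)) * (cmod (F t))\<^sup>2) \<in> borel_measurable lborel"
      using F(1) by measurable
    show "norm ((1 + \<bar>t\<bar> powr (2 * \<alpha>)) * (cmod (F t))\<^sup>2) \<le> (1 + \<bar>L\<bar> powr (2 * \<alpha>)) * C\<^sup>2" for t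
    proof (cases "t \<in> {-L..L}")
      case True
      have "\<bar>t\<bar> powr (2 * \<alpha>) \<le> \<bar>L\<bar> powr (2 * \<alpha>)"
        using True assms(4) by (intro powr_mono2) auto
      moreover have "(cmod (F t))\<^sup>2 \<le> C\<^sup>2" using F(2) by (intro power_mono) auto
      ultimately show ?thesis by (auto simp: abs_mult intro!: mult_mono)
    next
      case False
      then have "F t = 0" using F(3) L by blast
      then show ?thesis by simp
    qed
    show "(1 + \<bar>t\<bar> powr (2 * \<alpha>)) * (cmod (F t))\<^sup>2 = 0" if "t \<notin> {-L..L}" for t
    proof -
      have "F t = 0" using F(3) L that by blast
      then show ?thesis by simp
    qed
  qed
  then show ?thesis unfolding W_space_def
    using F(1,3,4) assms(2) by (auto simp: unit_char_def intro!: exI[of _ F])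
qed

section \<open>A quadratic bump and the decay of its transform\<close>

text \<open>Vanishing at both endpoints removes the term of order \<open>1/x\<close> from the
  transform, which leaves quadratic decay, summable over separated points. The factor 6 normalises
  the integral to 1.\<close>

definition bump :: "real \<Rightarrow> real" where
  "bump t = 6 * t * (1 - t) * indicator {0..1} t"

definition bump_ft :: "real \<Rightarrow> complex" where
  "bump_ft x = (LINT t|lborel. complex_of_real (bump t) * unit_char (t * x))"

lemma bump_measurable [measurable]: "bump \<in> borel_measurable borel"
  unfolding bump_def by measurable

lemma bump_nonneg: "0 \<le> bump t"
  by (auto simp: bump_def indicator_def)

lemma bump_le: "bump t \<le> 2"
proof -
  have "0 \<le> (2 * t - 1)\<^sup>2" by simp
  then have "6 * t * (1 - t) \<le> 2" by (simp add: power2_eq_square algebra_simps)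
  then show ?thesis by (auto simp: bump_def indicator_def)
qed

lemma bump_eq_0: "t \<notin> {0..1} \<Longrightarrow> bump t = 0"
  by (simp add: bump_def)

lemma has_bochner_integral_bump: "has_bochner_integral lborel bump 1"
proof -
  have "has_bochner_integral lborel (\<lambda>t. indicator {0..1} t *\<^sub>R (6 * t * (1 - t)) :: real) 
     ((3 * 1\<^sup>2 - 2 * 1 ^ 3) - (3 * 0\<^sup>2 - 2 * 0 ^ 3))"
    by (rule has_bochner_integral_FTC_Icc)
       (auto intro!: derivative_eq_intros continuous_intros
             simp flip: has_real_derivative_iff_has_vector_derivative
             simp: power2_eq_square algebra_simps)
  then show ?thesis by (simp add: bump_def[abs_def] mult.commute)
qed

lemma integral_bump: "integral\<^sup>L lborel bump = 1" and integrable_bump: "integrable lborel bump"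
  using has_bochner_integral_bump by (auto simp: has_bochner_integral_iff)

lemma bump_ft_0: "bump_ft 0 = 1"
  by (simp add: bump_ft_def integral_bump)

lemma norm_bump_ft_le_1: "norm (bump_ft x) \<le> 1"
proof -
  have "norm (bump_ft x) \<le> (LINT t|lborel. norm (complex_of_real (bump t) * unit_char (t * x)))"
    unfolding bump_ft_def by (rule integral_norm_bound)
  then show ?thesis by (simp add: norm_mult bump_nonneg integral_bump)
qed

lemma bump_ft_eq:
  fixes x :: real
  assumes "x \<noteq> 0"
  defines "w \<equiv> \<i> * complex_of_real (2 * pi * x)"
  shows "bump_ft x = 6 * (unit_char x + 1) / w\<^sup>2 - 12 * (unit_char x - 1) / w ^ 3"
proof -
  have w: "w \<noteq> 0" using assms by auto
  \<comment> \<open>Repeated integration by parts: with \<open>p = 6 t (1 - t)\<close> the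
    antiderivative of \<open>p * exp (w t)\<close> is
    \<open>exp (w t) * (p/w - p'/w^2 + p''/w^3)\<close>. The first term vanishes at 0 and 1.\<close>
  define A where "A = (\<lambda>t. exp (w * complex_of_real t) *
     (6 * complex_of_real t * (1 - complex_of_real t) / w - (6 - 12 * complex_of_real t) / w\<^sup>2 - 12 / w ^ 3))"
  have uc: "unit_char (t * x) = exp (w * complex_of_real t)" for t
    by (simp add: unit_char_def w_def mult_ac)
  have "(LINT t|lborel. indicator {0..1} t *\<^sub>R (6 * complex_of_real t * (1 - complex_of_real t) * exp (w * complex_of_real t)))
      = A 1 - A 0"
  proof (rule integral_FTC_Icc)
    fix t :: real
    have "((\<lambda>z. exp (w * z) * (6 * z * (1 - z) / w - (6 - 12 * z) / w\<^sup>2 - 12 / w ^ 3))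
        has_field_derivative 6 * complex_of_real t * (1 - complex_of_real t) * exp (w * complex_of_real t)) (at (complex_of_real t))"
      using w by (auto intro!: derivative_eq_intros simp: field_simps power2_eq_square power3_eq_cube)
    then show "(A has_vector_derivative 6 * complex_of_real t * (1 - complex_of_real t) * exp (w * complex_of_real t)) (at t within {0..1})"
      unfolding A_def by (rule has_vector_derivative_real_field)
  qed (auto intro!: continuous_intros)
  also have "(LINT t|lborel. indicator {0..1} t *\<^sub>R (6 * complex_of_real t * (1 - complex_of_real t) * exp (w * complex_of_real t))) = bump_ft x"
    unfolding bump_ft_def uc by (intro Bochner_Integration.integral_cong) (auto simp: bump_def indicator_def)
  finally have "bump_ft x = A 1 - A 0" .
  then show ?thesis
    using uc[of 1] by (simp add: A_def ring_distribs diff_divide_distrib add_divide_distrib)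
qed

lemma norm_bump_ft_decay: "norm (bump_ft x) * x\<^sup>2 \<le> 1"
proof (cases "\<bar>x\<bar> \<le> 1")
  case True
  then have "x\<^sup>2 \<le> 1" by (simp add: abs_square_le_1)
  then show ?thesis using norm_bump_ft_le_1[of x] mult_mono[of "norm (bump_ft x)" 1 "x\<^sup>2" 1] by simp
next
  case False
  define w where "w = \<i> * complex_of_real (2 * pi * x)"
  have nw: "norm w = 2 * pi * \<bar>x\<bar>" by (simp add: w_def norm_mult abs_mult)
  have nw6: "norm w \<ge> 6 * \<bar>x\<bar>" unfolding nw using pi_gt3 by (intro mult_right_mono) auto
  with False have nw6': "norm w \<ge> 6" by linarith
  then have nw0: "norm w > 0" by linarith
  have "norm (bump_ft x) \<le> norm (6 * (unit_char x + 1) / w\<^sup>2) + norm (12 * (unit_char x - 1) / w ^ 3)"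
    using bump_ft_eq[of x] False unfolding w_def by (auto intro: norm_triangle_ineq4)
  also have "\<dots> \<le> 12 / norm w ^ 2 + 24 / norm w ^ 3"
    using norm_triangle_ineq[of "unit_char x" 1] norm_triangle_ineq4[of "unit_char x" 1]
    by (intro add_mono) (auto simp: norm_divide norm_mult norm_power intro!: divide_right_mono simp del: distrib_left_numeral right_diff_distrib_numeral)
  \<comment> \<open>Trading one factor \<open>norm w \<ge> 6\<close> merges the two terms into
    \<open>16 / norm w ^ 2\<close>, and 16 is below 36.\<close>
  also have "24 / norm w ^ 3 \<le> 24 / (6 * norm w ^ 2)"
    using nw6' nw0 by (intro divide_left_mono mult_pos_pos zero_less_power)
      (auto simp: eval_nat_numeral intro!: mult_right_mono)
  also have "12 / norm w ^ 2 + 24 / (6 * norm w ^ 2) = 16 / norm w ^ 2" by simp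
  also have "\<dots> \<le> 16 / (6 * \<bar>x\<bar>) ^ 2"
    using nw6 nw0 False by (intro divide_left_mono power_mono) auto
  also have "\<dots> \<le> 1 / x\<^sup>2" using False by (simp add: power_mult_distrib field_simps)
  finally show ?thesis using False by (simp add: field_simps)
qed

lemma bump_translate_integral:
  "(LINT t|lborel. unit_char (- \<mu> * t) * complex_of_real (bump (t - g)) * unit_char (t * x))
     = unit_char (g * (x - \<mu>)) * bump_ft (x - \<mu>)"
proof -
  have "(LINT t|lborel. unit_char (- \<mu> * t) * complex_of_real (bump (t - g)) * unit_char (t * x))
      = (LINT t|lborel. unit_char (- \<mu> * (g + t)) * complex_of_real (bump (g + t - g)) * unit_char ((g + t) * x))"
    using lborel_integral_real_affine[of 1 "\<lambda>t. unit_char (- \<mu> * t) * complex_of_real (bump (t - g)) * unit_char (t * x)" g]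
    by simp
  also have "\<dots> = (LINT t|lborel. unit_char (g * (x - \<mu>)) * (complex_of_real (bump t) * unit_char (t * (x - \<mu>))))"
    by (intro Bochner_Integration.integral_cong refl)
       (simp add: unit_char_add[symmetric] algebra_simps)
  also have "\<dots> = unit_char (g * (x - \<mu>)) * bump_ft (x - \<mu>)"
    by (simp add: bump_ft_def)
  finally show ?thesis .
qed

text \<open>Translating the bump to start at \<open>g\<close> produces the character, and modulating
  by \<open>unit_char (- \<mu> * t)\<close> recentres the function at \<open>\<mu>\<close>. The
  bound 2 depends on neither \<open>g\<close> nor \<open>\<mu>\<close>.\<close>

lemma spectral_rep_bump_translate:
  "spectral_rep {g..g + 1} 2 (\<lambda>x. unit_char (g * (x - \<mu>)) * bump_ft (x - \<mu>))"
  unfolding spectral_rep_def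
  by (rule exI[of _ "\<lambda>t. unit_char (- \<mu> * t) * complex_of_real (bump (t - g))"])
     (use bump_translate_integral in \<open>auto simp: norm_mult bump_nonneg bump_le bump_eq_0\<close>)

section \<open>Counting and tail sums over separated sets\<close>

definition separated :: "real \<Rightarrow> real set \<Rightarrow> bool" where
  "separated \<delta> \<Lambda> \<longleftrightarrow> (\<forall>x\<in>\<Lambda>. \<forall>y\<in>\<Lambda>. x \<noteq> y \<longrightarrow> \<delta> \<le> \<bar>x - y\<bar>)"

lemma separated_subset: "separated \<delta> \<Lambda> \<Longrightarrow> B \<subseteq> \<Lambda> \<Longrightarrow> separated \<delta> B"
  by (auto simp: separated_def)

lemma separated_uminus: "separated \<delta> B \<Longrightarrow> separated \<delta> (uminus ` B)"
  by (fastforce simp: separated_def)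

lemma separated_shift: "separated \<delta> B \<Longrightarrow> separated \<delta> ((\<lambda>x. x - \<mu>) ` B)"
  by (fastforce simp: separated_def)

text \<open>Each half-open cell of length \<open>\<delta>\<close> holds at most one point, so sums
  over separated sets reduce to sums over integers.\<close>

lemma inj_on_floor_separated:
  assumes "\<delta> > 0" "separated \<delta> B"
  shows "inj_on (\<lambda>x. \<lfloor>x / \<delta>\<rfloor>) B"
proof (rule inj_onI, rule ccontr)
  fix x y assume xy: "x \<in> B" "y \<in> B" "\<lfloor>x / \<delta>\<rfloor> = \<lfloor>y / \<delta>\<rfloor>" "x \<noteq> y"
  have "\<bar>x / \<delta> - y / \<delta>\<bar> < 1" using xy(3) by linarith
  then have "\<bar>x - y\<bar> < \<delta>" using assms(1) by (simp flip: diff_divide_distrib add: abs_divide)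
  then show False using assms(2) xy unfolding separated_def by fastforce
qed

lemma card_separated_le:
  assumes "\<delta> > 0" "separated \<delta> B" "\<And>x. x \<in> B \<Longrightarrow> \<bar>x\<bar> < real n * \<delta>"
  shows "finite B" "card B \<le> 2 * n"
proof -
  have sub: "(\<lambda>x. \<lfloor>x / \<delta>\<rfloor>) ` B \<subseteq> {- int n..<int n}"
  proof
    fix k assume "k \<in> (\<lambda>x. \<lfloor>x / \<delta>\<rfloor>) ` B"
    then obtain x where x: "x \<in> B" "k = \<lfloor>x / \<delta>\<rfloor>" by auto
    have "- real n < x / \<delta>" "x / \<delta> < real n"
      using assms(3)[OF x(1)] assms(1) by (auto simp: field_simps abs_less_iff)
    then show "k \<in> {- int n..<int n}" unfolding x(2) by (simp add: le_floor_iff floor_less_iff)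
  qed
  note inj = inj_on_floor_separated[OF assms(1,2)]
  show "finite B" using inj sub finite_imageD finite_subset by blast
  show "card B \<le> 2 * n" using card_inj_on_le[OF inj sub] by simp
qed

lemma summable_finite_tail:
  fixes w :: "nat \<Rightarrow> real"
  assumes "summable w" "\<And>k. 0 \<le> w k" "e > 0"
  obtains n where "\<And>A. finite A \<Longrightarrow> A \<subseteq> {n..} \<Longrightarrow> sum w A \<le> e"
proof -
  obtain n where n: "\<And>j k. n \<le> j \<Longrightarrow> norm (sum w {j..<k}) < e"
    using assms(1,3) unfolding summable_Cauchy by blast
  have "sum w A \<le> e" if "finite A" "A \<subseteq> {n..}" for A
  proof -
    have "A \<subseteq> {n..<Suc (Max (insert 0 A))}" using that by (auto simp: less_Suc_eq_le)
    then have "sum w A \<le> sum w {n..<Suc (Max (insert 0 A))}"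
      using assms(2) by (intro sum_mono2) auto
    also have "\<dots> \<le> e" using n[of n "Suc (Max (insert 0 A))"] by simp
    finally show ?thesis .
  qed
  then show ?thesis using that by blast
qed

text \<open>Cell indices compare each half-line with the tail of the series of
  \<open>1 / (k * \<delta>)^2\<close>. The threshold \<open>n\<close> is chosen before
  \<open>B\<close>, so it serves all separated sets at once.\<close>

lemma bump_ft_tail_le:
  assumes "\<delta> > 0" "e > 0"
  obtains n where "\<And>B. finite B \<Longrightarrow> separated \<delta> B \<Longrightarrow> (\<And>x. x \<in> B \<Longrightarrow> real n * \<delta> \<le> \<bar>x\<bar>)
     \<Longrightarrow> (\<Sum>x\<in>B. norm (bump_ft x)) \<le> e"
proof -
  define w where "w = (\<lambda>k::nat. inverse (\<delta>\<^sup>2) * inverse (real k ^ 2))"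
  have "summable w" unfolding w_def by (intro summable_mult inverse_power_summable) auto
  then obtain n0 where n0: "\<And>A. finite A \<Longrightarrow> A \<subseteq> {n0..} \<Longrightarrow> sum w A \<le> e / 2"
    using summable_finite_tail[of w "e / 2"] assms by (auto simp: w_def)
  \<comment> \<open>The successor keeps all cell indices positive; \<open>w 0\<close> is 0 by the
    convention for \<open>inverse\<close> and would bound nothing.\<close>
  define n where "n = Suc n0"
  have one_sided: "(\<Sum>x\<in>B. inverse (x\<^sup>2)) \<le> e / 2"
    if B: "finite B" "separated \<delta> B" "\<And>x. x \<in> B \<Longrightarrow> real n * \<delta> \<le> x" for B
  proof -
    define \<psi> where "\<psi> = (\<lambda>x. nat \<lfloor>x / \<delta>\<rfloor>)"
    have \<psi>: "int n \<le> \<lfloor>x / \<delta>\<rfloor>" if "x \<in> B" for x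
      using B(3)[OF that] assms(1) by (simp add: le_floor_iff field_simps)
    have inj: "inj_on \<psi> B"
    proof (rule inj_onI)
      fix x y assume xy: "x \<in> B" "y \<in> B" "\<psi> x = \<psi> y"
      then have "\<lfloor>x / \<delta>\<rfloor> = \<lfloor>y / \<delta>\<rfloor>" using \<psi>[OF xy(1)] \<psi>[OF xy(2)] unfolding \<psi>_def by linarith
      then show "x = y" using inj_on_floor_separated[OF assms(1) B(2)] xy by (auto dest: inj_onD)
    qed
    have "inverse (x\<^sup>2) \<le> w (\<psi> x)" if "x \<in> B" for x
    proof -
      have "real (\<psi> x) = of_int \<lfloor>x / \<delta>\<rfloor>" using \<psi>[OF that] by (simp add: \<psi>_def)
      then have le: "real (\<psi> x) \<le> x / \<delta>" by simp
      have pos: "real (\<psi> x) > 0" using \<psi>[OF that] unfolding \<psi>_def n_def by linarith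
      have "\<delta> * real (\<psi> x) \<le> x" using le assms(1) by (simp add: field_simps)
      then have "(\<delta> * real (\<psi> x))\<^sup>2 \<le> x\<^sup>2" using assms(1) pos by (intro power_mono) auto
      then have "inverse (x\<^sup>2) \<le> inverse ((\<delta> * real (\<psi> x))\<^sup>2)"
        using assms(1) pos by (intro le_imp_inverse_le) auto
      then show ?thesis by (simp add: w_def power_mult_distrib)
    qed
    then have "(\<Sum>x\<in>B. inverse (x\<^sup>2)) \<le> (\<Sum>x\<in>B. w (\<psi> x))" by (rule sum_mono)
    also have "\<dots> = sum w (\<psi> ` B)" using inj by (simp add: sum.reindex)
    also have "\<dots> \<le> e / 2"
      using \<psi> B(1) by (intro n0) (fastforce simp: \<psi>_def n_def)+
    finally show ?thesis .
  qed
  have "(\<Sum>x\<in>B. norm (bump_ft x)) \<le> e"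
    if B: "finite B" "separated \<delta> B" "\<And>x. x \<in> B \<Longrightarrow> real n * \<delta> \<le> \<bar>x\<bar>" for B
  proof -
    have n\<delta>: "real n * \<delta> > 0" using assms(1) by (simp add: n_def)
    have "norm (bump_ft x) \<le> inverse (x\<^sup>2)" if "x \<in> B" for x
      using norm_bump_ft_decay[of x] B(3)[OF that] n\<delta> by (auto simp: field_simps)
    then have "(\<Sum>x\<in>B. norm (bump_ft x)) \<le> (\<Sum>x\<in>B. inverse (x\<^sup>2))" by (rule sum_mono)
    also have "\<dots> = (\<Sum>x\<in>B \<inter> {0..}. inverse (x\<^sup>2)) + (\<Sum>x\<in>B - {0..}. inverse (x\<^sup>2))"
      using B(1) by (rule sum.Int_Diff)
    \<comment> \<open>Negative points are reflected so that the one-sided estimate applies to them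
      too.\<close>
    also have "(\<Sum>x\<in>B - {0..}. inverse (x\<^sup>2)) = (\<Sum>x\<in>uminus ` (B - {0..}). inverse (x\<^sup>2))"
      by (subst sum.reindex) auto
    also have "\<dots> \<le> e / 2"
      using B by (intro one_sided separated_uminus[OF separated_subset[OF B(2)]]) (auto, fastforce)
    also have "(\<Sum>x\<in>B \<inter> {0..}. inverse (x\<^sup>2)) \<le> e / 2"
      using B(1,3) by (intro one_sided separated_subset[OF B(2)]) (auto, fastforce)
    finally show ?thesis by simp
  qed
  then show ?thesis using that by blast
qed

section \<open>Quantitative use of rational independence\<close>

lemma rationally_independent_nonzero:
  assumes "rationally_independent m q" "j < m" shows "q j \<noteq> 0"
proof
  assume "q j = 0"
  then have "(\<Sum>i<m. (if i = j then 1 else 0) * q i) = 0"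
    by (intro sum.neutral) auto
  then show False
    using assms unfolding rationally_independent_def
    by (auto dest!: spec[of _ "\<lambda>i. if i = j then 1 else 0"])
qed

text \<open>If \<open>q i * x\<close> and \<open>q j * x\<close> are integers, then
  \<open>(q j * x) * q i - (q i * x) * q j = 0\<close> is a rational relation, so its coefficients
  vanish; \<open>q j\<close> being nonzero then forces \<open>x = 0\<close>.\<close>

lemma rationally_independent_common_multiple:
  assumes q: "rationally_independent m q" and ij: "i < m" "j < m" "i \<noteq> j"
    and int: "q i * x \<in> \<int>" "q j * x \<in> \<int>"
  shows "x = 0"
proof (rule ccontr)
  assume x: "x \<noteq> 0"
  define r where "r = (\<lambda>k. if k = i then q j * x else if k = j then - (q i * x) else 0)"
  have "(\<Sum>k<m. r k * q k) = (\<Sum>k\<in>{i, j}. r k * q k)"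
    using ij by (intro sum.mono_neutral_right) (auto simp: r_def)
  also have "\<dots> = 0" using ij by (simp add: r_def)
  finally have "(\<Sum>k<m. r k * q k) = 0" .
  moreover have "\<forall>k<m. r k \<in> \<rat>" using int Ints_subset_Rats by (auto simp: r_def)
  ultimately have "r i = 0" using q ij(1) unfolding rationally_independent_def by blast
  then show False using rationally_independent_nonzero[OF q ij(2)] x by (simp add: r_def)
qed

text \<open>For a pair \<open>i \<noteq> j\<close> the larger of the two distances is continuous
  and, away from 0, never zero. Compactness gives a positive minimum, and there are finitely many
  pairs.\<close>

lemma rationally_independent_separation:
  assumes q: "rationally_independent m q" and "\<delta> > 0"
  obtains \<kappa> where "\<kappa> > 0" "\<And>x i j. \<delta> \<le> \<bar>x\<bar> \<Longrightarrow> \<bar>x\<bar> \<le> R \<Longrightarrow> i < m \<Longrightarrow> j < m \<Longrightarrow> i \<noteq> j \<Longrightarrow>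
     \<kappa> \<le> norm (unit_char (q i * x) - 1) \<or> \<kappa> \<le> norm (unit_char (q j * x) - 1)"
proof -
  define X where "X = {-R..-\<delta>} \<union> {\<delta>..R}"
  have X_iff: "x \<in> X \<longleftrightarrow> \<delta> \<le> \<bar>x\<bar> \<and> \<bar>x\<bar> \<le> R" for x using assms(2) by (auto simp: X_def)
  define P where "P = {(i, j). i < m \<and> j < m \<and> i \<noteq> j}"
  have "finite P" by (rule finite_subset[of _ "{..<m} \<times> {..<m}"]) (auto simp: P_def)
  define g where "g = (\<lambda>(i, j) x. max (norm (unit_char (q i * x) - 1)) (norm (unit_char (q j * x) - 1)))"
  have "\<exists>k>0. \<forall>x\<in>X. k \<le> g p x" if pP: "p \<in> P" for p
  proof (cases "X = {}")
    case False
    obtain i j where p: "p = (i, j)" "i < m" "j < m" "i \<noteq> j" using pP unfolding P_def by blast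
    have "continuous_on X (g p)" unfolding g_def p(1) by (auto intro!: continuous_intros)
    moreover have "compact X" by (auto simp: X_def intro!: compact_Un)
    ultimately obtain z where z: "z \<in> X" "\<And>x. x \<in> X \<Longrightarrow> g p z \<le> g p x"
      using continuous_attains_inf[of X "g p"] False by blast
    have "z \<noteq> 0" using z(1) X_iff assms(2) by auto
    then have "unit_char (q i * z) \<noteq> 1 \<or> unit_char (q j * z) \<noteq> 1"
      using rationally_independent_common_multiple[OF q p(2-4)] unit_char_eq_1_iff by blast
    then have "g p z > 0" by (auto simp: g_def p(1) less_max_iff_disj)
    then show ?thesis using z by blast
  qed (auto intro: exI[of _ 1])
  then obtain k where k: "\<And>p. p \<in> P \<Longrightarrow> k p > 0" "\<And>p x. p \<in> P \<Longrightarrow> x \<in> X \<Longrightarrow> k p \<le> g p x" by metis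
  \<comment> \<open>The inserted 1 gives \<open>Min\<close> a nonempty set when \<open>m < 2\<close>
    and no pairs exist.\<close>
  define \<kappa> where "\<kappa> = Min (insert 1 (k ` P))"
  have "\<kappa> > 0" unfolding \<kappa>_def using \<open>finite P\<close> k(1) by (subst Min_gr_iff) auto
  moreover have "\<kappa> \<le> g p x" if "p \<in> P" "x \<in> X" for p x
  proof -
    have "\<kappa> \<le> k p" unfolding \<kappa>_def using \<open>finite P\<close> that by (intro Min_le) auto
    then show ?thesis using k(2)[OF that] by simp
  qed
  ultimately show ?thesis
    using that[of \<kappa>] X_iff unfolding P_def g_def by (fastforce simp: le_max_iff_disj)
qed

section \<open>Means of characters along an arithmetic progression\<close>

text \<open>The sum starts at \<open>k = 1\<close> to match the progressions of property
  (C).\<close>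

definition dirichlet_mean :: "nat \<Rightarrow> real \<Rightarrow> complex" where
  "dirichlet_mean N y = (\<Sum>k=1..N. unit_char (real k * y)) / of_nat N"

lemma dirichlet_mean_0: "N > 0 \<Longrightarrow> dirichlet_mean N 0 = 1"
  by (simp add: dirichlet_mean_def)

lemma norm_dirichlet_mean_le_1: "norm (dirichlet_mean N y) \<le> 1"
proof -
  have "norm (\<Sum>k=1..N. unit_char (real k * y)) \<le> (\<Sum>k=1..N. norm (unit_char (real k * y)))"
    by (rule norm_sum)
  then show ?thesis by (cases "N = 0") (simp_all add: dirichlet_mean_def norm_divide divide_le_eq_1)
qed

lemma norm_dirichlet_mean_le:
  assumes "N > 0" "\<kappa> > 0" "\<kappa> \<le> norm (unit_char y - 1)"
  shows "norm (dirichlet_mean N y) \<le> 2 / (real N * \<kappa>)"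
proof -
  \<comment> \<open>The geometric sum telescopes; its two remaining terms have modulus 1, whence the
    constant 2.\<close>
  have "(\<Sum>k=1..n. unit_char (real k * y)) * (unit_char y - 1) = unit_char (real (Suc n) * y) - unit_char y" for n
  proof (induction n)
    case (Suc n)
    have step: "unit_char (real (Suc (Suc n)) * y) = unit_char (real (Suc n) * y) * unit_char y"
      by (simp add: unit_char_add[symmetric] algebra_simps)
    have split: "(\<Sum>k=1..Suc n. unit_char (real k * y)) = (\<Sum>k=1..n. unit_char (real k * y)) + unit_char (real (Suc n) * y)"
      by simp
    show ?case unfolding split step distrib_right Suc by (simp add: right_diff_distrib)
  qed simp
  then have "norm (\<Sum>k=1..N. unit_char (real k * y)) * norm (unit_char y - 1) \<le> 2"
    using norm_triangle_ineq4[of "unit_char (real (Suc N) * y)" "unit_char y"]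
    by (simp add: norm_mult[symmetric])
  moreover have "norm (\<Sum>k=1..N. unit_char (real k * y)) * \<kappa> \<le> norm (\<Sum>k=1..N. unit_char (real k * y)) * norm (unit_char y - 1)"
    using assms(3) by (intro mult_left_mono) auto
  ultimately show ?thesis using assms(1,2) by (simp add: dirichlet_mean_def norm_divide field_simps)
qed

text \<open>The function is the average of \<open>N\<close> translated bumps, so its density keeps
  the bound 2 however large \<open>N\<close> is.\<close>

lemma spectral_rep_dirichlet_bump:
  assumes K: "bounded K" "\<And>k. k \<in> {1..N} \<Longrightarrow> {a + real k * q..a + real k * q + 1} \<subseteq> K" and "N > 0"
  shows "spectral_rep K 2 (\<lambda>x. unit_char (a * (x - \<mu>)) * dirichlet_mean N (q * (x - \<mu>)) * bump_ft (x - \<mu>))"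
proof -
  have "spectral_rep K (\<Sum>k=1..N. norm (1 / of_nat N :: complex) * 2)
     (\<lambda>x. \<Sum>k=1..N. 1 / of_nat N * (unit_char ((a + real k * q) * (x - \<mu>)) * bump_ft (x - \<mu>)))"
    using K by (intro spectral_rep_sum spectral_rep_scale spectral_rep_mono[OF spectral_rep_bump_translate]) auto
  moreover have "(\<Sum>k=1..N. norm (1 / of_nat N :: complex) * 2) = 2" using assms(3) by (simp add: norm_divide)
  moreover have "(\<lambda>x. \<Sum>k=1..N. 1 / of_nat N * (unit_char ((a + real k * q) * (x - \<mu>)) * bump_ft (x - \<mu>)))
     = (\<lambda>x. unit_char (a * (x - \<mu>)) * dirichlet_mean N (q * (x - \<mu>)) * bump_ft (x - \<mu>))"
  proof
    fix x
    have "unit_char ((a + real k * q) * (x - \<mu>)) = unit_char (a * (x - \<mu>)) * unit_char (real k * (q * (x - \<mu>)))" for k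
      by (simp add: unit_char_add[symmetric] algebra_simps)
    then show "(\<Sum>k=1..N. 1 / of_nat N * (unit_char ((a + real k * q) * (x - \<mu>)) * bump_ft (x - \<mu>)))
       = unit_char (a * (x - \<mu>)) * dirichlet_mean N (q * (x - \<mu>)) * bump_ft (x - \<mu>)"
      by (simp add: dirichlet_mean_def sum_distrib_left sum_distrib_right sum_divide_distrib mult_ac)
  qed
  ultimately show ?thesis by metis
qed

section \<open>Localized functions from property (C)\<close>

text \<open>\<open>n\<close>, \<open>m\<close>, \<open>q\<close>, \<open>\<kappa>\<close>,
  \<open>N\<close> and \<open>a\<close> are fixed before \<open>\<Lambda>\<close> and
  \<open>\<mu>\<close> appear. Only the index \<open>j\<close> depends on them, and \<open>K\<close>
  contains the blocks of all indices; hence one bounded \<open>K\<close> serves every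
  centre.\<close>

lemma exists_localized_function:
  assumes C: "property_C \<Gamma>" and \<delta>: "\<delta> > 0"
  obtains K where "bounded K" "K \<subseteq> (\<Union>g\<in>\<Gamma>. {g..g + 1})"
    "\<And>\<Lambda> \<mu>. separated \<delta> \<Lambda> \<Longrightarrow> \<mu> \<in> \<Lambda> \<Longrightarrow> \<exists>f. spectral_rep K 2 f \<and> f \<mu> = 1 \<and>
       (\<forall>B. finite B \<longrightarrow> B \<subseteq> \<Lambda> - {\<mu>} \<longrightarrow> (\<Sum>x\<in>B. norm (f x)) \<le> 1 / 2)"
proof -
  obtain n where tail: "\<And>B. finite B \<Longrightarrow> separated \<delta> B \<Longrightarrow> (\<And>x. x \<in> B \<Longrightarrow> real n * \<delta> \<le> \<bar>x\<bar>)
     \<Longrightarrow> (\<Sum>x\<in>B. norm (bump_ft x)) \<le> 1 / 4"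
    using bump_ft_tail_le[OF \<delta>, of "1 / 4"] by auto
  \<comment> \<open>One more than the \<open>2 * n\<close> points that a separated set can have
    within distance \<open>n * \<delta>\<close> of the centre.\<close>
  define m where "m = 2 * n + 1"
  obtain q where q: "rationally_independent m q"
    and C_q: "\<And>N::nat. \<exists>a::nat \<Rightarrow> real. (\<Union>j<m. {a j + real k * q j | k. k \<in> {1..N}}) \<subseteq> \<Gamma>"
    using C unfolding property_C_def by blast
  obtain \<kappa> where \<kappa>: "\<kappa> > 0" "\<And>x i j. \<delta> \<le> \<bar>x\<bar> \<Longrightarrow> \<bar>x\<bar> \<le> real n * \<delta> \<Longrightarrow> i < m \<Longrightarrow> j < m \<Longrightarrow> i \<noteq> j \<Longrightarrow>
     \<kappa> \<le> norm (unit_char (q i * x) - 1) \<or> \<kappa> \<le> norm (unit_char (q j * x) - 1)"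
    using rationally_independent_separation[OF q \<delta>, of "real n * \<delta>"] by blast
  \<comment> \<open>Chosen so that \<open>2 * n\<close> near points, each contributing at most
    \<open>2 / (N * \<kappa>)\<close>, add up to at most \<open>1/4\<close>.\<close>
  obtain N :: nat where N: "real N > 16 * real n / \<kappa>" using reals_Archimedean2 by blast
  have "0 \<le> 16 * real n / \<kappa>" using \<kappa>(1) by simp
  then have N0: "N > 0" using N by (cases N) auto
  obtain a :: "nat \<Rightarrow> real" where a: "(\<Union>j<m. {a j + real k * q j | k. k \<in> {1..N}}) \<subseteq> \<Gamma>"
    using C_q by blast
  define K where "K = (\<Union>j<m. \<Union>k\<in>{1..N}. {a j + real k * q j..a j + real k * q j + 1})"
  have K: "bounded K" unfolding K_def by (intro bounded_UN ballI) auto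
  have "K \<subseteq> (\<Union>g\<in>\<Gamma>. {g..g + 1})"
  proof
    fix t assume "t \<in> K"
    then obtain j k where jk: "j < m" "k \<in> {1..N}" "t \<in> {a j + real k * q j..a j + real k * q j + 1}"
      unfolding K_def by blast
    then have "a j + real k * q j \<in> \<Gamma>" using a by blast
    then show "t \<in> (\<Union>g\<in>\<Gamma>. {g..g + 1})" using jk(3) by blast
  qed
  moreover have "\<exists>f. spectral_rep K 2 f \<and> f \<mu> = 1 \<and>
       (\<forall>B. finite B \<longrightarrow> B \<subseteq> \<Lambda> - {\<mu>} \<longrightarrow> (\<Sum>x\<in>B. norm (f x)) \<le> 1 / 2)"
    if \<Lambda>: "separated \<delta> \<Lambda>" "\<mu> \<in> \<Lambda>" for \<Lambda> \<mu>
  proof -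
    define P where "P = {p \<in> (\<lambda>x. x - \<mu>) ` (\<Lambda> - {\<mu>}). \<bar>p\<bar> < real n * \<delta>}"
    have sepP: "separated \<delta> P"
      using separated_subset[OF separated_shift[OF \<Lambda>(1)], of P \<mu>] by (auto simp: P_def)
    have P: "finite P" "card P \<le> 2 * n"
      using card_separated_le[OF \<delta> sepP, of n] by (auto simp: P_def)
    have P_ge: "\<delta> \<le> \<bar>p\<bar>" if "p \<in> P" for p
      using that \<Lambda> by (auto simp: P_def separated_def)
    \<comment> \<open>Each bad index picks a near point that spoils it. By the choice of
      \<open>\<kappa>\<close> no point spoils two indices, so there are at most
      \<open>2 * n < m\<close> bad ones.\<close>
    define bad where "bad = {j. j < m \<and> (\<exists>p\<in>P. norm (unit_char (q j * p) - 1) < \<kappa>)}"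
    have "\<forall>j\<in>bad. \<exists>p\<in>P. norm (unit_char (q j * p) - 1) < \<kappa>" by (auto simp: bad_def)
    then obtain pt where pt: "\<And>j. j \<in> bad \<Longrightarrow> pt j \<in> P \<and> norm (unit_char (q j * pt j) - 1) < \<kappa>"
      by metis
    have "inj_on pt bad"
    proof (rule inj_onI, rule ccontr)
      fix i j assume ij: "i \<in> bad" "j \<in> bad" "pt i = pt j" "i \<noteq> j"
      have "\<delta> \<le> \<bar>pt i\<bar>" "\<bar>pt i\<bar> \<le> real n * \<delta>" using pt[OF ij(1)] P_ge by (auto simp: P_def)
      then show False using \<kappa>(2)[of "pt i" i j] ij pt[OF ij(1)] pt[OF ij(2)] by (auto simp: bad_def)
    qed
    then have "card bad \<le> card P" using pt P(1) by (intro card_inj_on_le[of pt]) auto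
    then have "card bad < card {..<m}" using P(2) by (simp add: m_def)
    moreover have "bad \<subseteq> {..<m}" by (auto simp: bad_def)
    ultimately obtain j where j: "j < m" "j \<notin> bad" by (metis lessThan_iff less_irrefl subset_antisym subsetI)
    define f where "f = (\<lambda>x. unit_char (a j * (x - \<mu>)) * dirichlet_mean N (q j * (x - \<mu>)) * bump_ft (x - \<mu>))"
    have "spectral_rep K 2 f"
      unfolding f_def using j(1) by (intro spectral_rep_dirichlet_bump K N0) (unfold K_def, blast)
    moreover have "f \<mu> = 1" using N0 by (simp add: f_def dirichlet_mean_0 bump_ft_0)
    moreover have "(\<Sum>x\<in>B. norm (f x)) \<le> 1 / 2" if B: "finite B" "B \<subseteq> \<Lambda> - {\<mu>}" for B
    proof -
      define B' where "B' = (\<lambda>x. x - \<mu>) ` B"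
      define near where "near = {p \<in> B'. \<bar>p\<bar> < real n * \<delta>}"
      define far where "far = {p \<in> B'. real n * \<delta> \<le> \<bar>p\<bar>}"
      have B': "finite B'" "near \<union> far = B'" "near \<inter> far = {}" "near \<subseteq> P"
        using B by (auto simp: B'_def near_def far_def P_def)
      have far_le: "(\<Sum>p\<in>far. norm (bump_ft p)) \<le> 1 / 4"
      proof (rule tail)
        show "separated \<delta> far"
          by (rule separated_subset[OF separated_shift[OF \<Lambda>(1)], of _ \<mu>])
             (use B in \<open>auto simp: far_def B'_def\<close>)
      qed (use B'(1) in \<open>auto simp: far_def\<close>)
      have near_pt: "norm (dirichlet_mean N (q j * p)) \<le> 2 / (real N * \<kappa>)" if "p \<in> near" for p
        using that B'(4) j by (intro norm_dirichlet_mean_le N0 \<kappa>(1)) (force simp: bad_def)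
      have "(\<Sum>x\<in>B. norm (f x)) = (\<Sum>p\<in>B'. norm (dirichlet_mean N (q j * p)) * norm (bump_ft p))"
        unfolding B'_def f_def by (subst sum.reindex) (auto simp: norm_mult inj_on_def)
      \<comment> \<open>Near points are handled by the small mean with the transform bounded by 1;
        far points by the decay of the transform with the mean bounded by 1.\<close>
      also have "\<dots> = (\<Sum>p\<in>near. norm (dirichlet_mean N (q j * p)) * norm (bump_ft p))
          + (\<Sum>p\<in>far. norm (dirichlet_mean N (q j * p)) * norm (bump_ft p))"
        unfolding B'(2)[symmetric] using B' by (intro sum.union_disjoint) (auto intro: finite_subset)
      also have "(\<Sum>p\<in>far. norm (dirichlet_mean N (q j * p)) * norm (bump_ft p)) \<le> (\<Sum>p\<in>far. 1 * norm (bump_ft p))"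
        using norm_dirichlet_mean_le_1 by (intro sum_mono mult_right_mono) auto
      also have "\<dots> \<le> 1 / 4" using far_le by simp
      also have "(\<Sum>p\<in>near. norm (dirichlet_mean N (q j * p)) * norm (bump_ft p)) \<le> (\<Sum>p\<in>near. 2 / (real N * \<kappa>) * 1)"
        using near_pt norm_bump_ft_le_1 \<kappa>(1) by (intro sum_mono mult_mono) auto
      also have "\<dots> = real (card near) * (2 / (real N * \<kappa>))" by simp
      also have "\<dots> \<le> real (2 * n) * (2 / (real N * \<kappa>))"
        using card_mono[OF P(1) B'(4)] P(2) \<kappa>(1) N0 by (intro mult_right_mono) auto
      also have "\<dots> \<le> 1 / 4" using N \<kappa>(1) N0 by (simp add: field_simps)
      finally show ?thesis by simp
    qed
    ultimately show ?thesis by blast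
  qed
  ultimately show ?thesis using that K by blast
qed

section \<open>Interpolation of absolutely summable data\<close>

text \<open>Finite subsets express the norm bound without enumerating \<open>\<Lambda>\<close> or
  discussing summability over it.\<close>

definition l1_bound :: "real set \<Rightarrow> (real \<Rightarrow> complex) \<Rightarrow> real \<Rightarrow> bool" where
  "l1_bound \<Lambda> d s \<longleftrightarrow> (\<forall>B. finite B \<longrightarrow> B \<subseteq> \<Lambda> \<longrightarrow> (\<Sum>x\<in>B. norm (d x)) \<le> s)"

text \<open>A finite set whose sum comes within \<open>e\<close> of the supremum leaves mass at most
  \<open>e\<close> for any disjoint finite set.\<close>

lemma l1_bound_finite_exhaustion:
  assumes d: "l1_bound \<Lambda> d s" and "e > 0"
  obtains A where "finite A" "A \<subseteq> \<Lambda>" "l1_bound (\<Lambda> - A) d e"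
proof -
  define T where "T = (\<lambda>B. \<Sum>x\<in>B. norm (d x)) ` {B. finite B \<and> B \<subseteq> \<Lambda>}"
  have T: "T \<noteq> {}" "bdd_above T" using d by (auto simp: T_def l1_bound_def intro!: bdd_aboveI[of _ s])
  obtain t where "t \<in> T" "Sup T - e < t" using less_cSupD[OF T(1), of "Sup T - e"] assms(2) by auto
  then obtain A where A: "finite A" "A \<subseteq> \<Lambda>" "Sup T - e < (\<Sum>x\<in>A. norm (d x))" by (auto simp: T_def)
  have "(\<Sum>x\<in>B. norm (d x)) \<le> e" if B: "finite B" "B \<subseteq> \<Lambda> - A" for B
  proof -
    have "(\<Sum>x\<in>A \<union> B. norm (d x)) \<le> Sup T"
      using A B by (intro cSup_upper T(2)) (auto simp: T_def)
    moreover have "(\<Sum>x\<in>A \<union> B. norm (d x)) = (\<Sum>x\<in>A. norm (d x)) + (\<Sum>x\<in>B. norm (d x))"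
      using A B by (intro sum.union_disjoint) auto
    ultimately show ?thesis using A(3) by linarith
  qed
  then show ?thesis using that A unfolding l1_bound_def by blast
qed

text \<open>
  Only the data on a finite set carrying all but a quarter of the \<open>l\<^sup>1\<close> mass are corrected, so that
  \<open>g\<close> is a finite combination; the error factor becomes \<open>1/4 + 1/2\<close>.
\<close>

lemma interpolation_step:
  assumes K: "bounded K" and C: "0 \<le> C"
    and f: "\<And>\<mu>. \<mu> \<in> \<Lambda> \<Longrightarrow> \<exists>f. spectral_rep K C f \<and> f \<mu> = 1 \<and>
       (\<forall>B. finite B \<longrightarrow> B \<subseteq> \<Lambda> - {\<mu>} \<longrightarrow> (\<Sum>x\<in>B. norm (f x)) \<le> 1 / 2)"
    and d: "l1_bound \<Lambda> d s" and s: "s > 0"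
  shows "\<exists>g. spectral_rep K (C * s) g \<and> l1_bound \<Lambda> (\<lambda>x. d x - g x) (3 / 4 * s)"
proof -
  obtain f where f: "\<And>\<mu>. \<mu> \<in> \<Lambda> \<Longrightarrow> spectral_rep K C (f \<mu>)" "\<And>\<mu>. \<mu> \<in> \<Lambda> \<Longrightarrow> f \<mu> \<mu> = 1"
    "\<And>\<mu> B. \<mu> \<in> \<Lambda> \<Longrightarrow> finite B \<Longrightarrow> B \<subseteq> \<Lambda> - {\<mu>} \<Longrightarrow> (\<Sum>x\<in>B. norm (f \<mu> x)) \<le> 1 / 2"
    using f by metis
  obtain A where A: "finite A" "A \<subseteq> \<Lambda>" "l1_bound (\<Lambda> - A) d (s / 4)"
    using l1_bound_finite_exhaustion[OF d, of "s / 4"] s by auto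
  have A_sum: "(\<Sum>\<mu>\<in>A. norm (d \<mu>)) \<le> s" using d A unfolding l1_bound_def by blast
  define g where "g = (\<lambda>x. \<Sum>\<mu>\<in>A. d \<mu> * f \<mu> x)"
  have "spectral_rep K (\<Sum>\<mu>\<in>A. norm (d \<mu>) * C) g"
    unfolding g_def using A f(1) by (intro spectral_rep_sum spectral_rep_scale K) auto
  then have "spectral_rep K (C * s) g"
    by (rule spectral_rep_mono)
       (use A_sum C in \<open>auto simp: sum_distrib_right[symmetric] mult.commute[of C] intro: mult_right_mono\<close>)
  moreover have "(\<Sum>x\<in>B. norm (d x - g x)) \<le> 3 / 4 * s" if B: "finite B" "B \<subseteq> \<Lambda>" for B
  proof -
    have pt: "norm (d x - g x) \<le> (if x \<in> A then 0 else norm (d x)) + (\<Sum>\<mu>\<in>A. norm (d \<mu>) * (if x = \<mu> then 0 else norm (f \<mu> x)))"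
      if x: "x \<in> B" for x
    proof -
      \<comment> \<open>Since \<open>f \<mu> \<mu> = 1\<close>, the diagonal term reproduces
        \<open>d\<close> exactly on \<open>A\<close>; only off-diagonal terms remain as
        error.\<close>
      have "g x = (if x \<in> A then d x else 0) + (\<Sum>\<mu>\<in>A. d \<mu> * (if x = \<mu> then 0 else f \<mu> x))"
      proof -
        have "g x = (\<Sum>\<mu>\<in>A. (if x = \<mu> then d x else 0) + d \<mu> * (if x = \<mu> then 0 else f \<mu> x))"
          unfolding g_def using x B f(2) by (intro sum.cong) auto
        then show ?thesis using A(1) by (simp add: sum.distrib sum.delta')
      qed
      then have "d x - g x = (if x \<in> A then 0 else d x) - (\<Sum>\<mu>\<in>A. d \<mu> * (if x = \<mu> then 0 else f \<mu> x))"
        by simp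
      then have "norm (d x - g x) \<le> norm (if x \<in> A then 0 else d x) + norm (\<Sum>\<mu>\<in>A. d \<mu> * (if x = \<mu> then 0 else f \<mu> x))"
        by (metis norm_triangle_ineq4)
      also have "norm (\<Sum>\<mu>\<in>A. d \<mu> * (if x = \<mu> then 0 else f \<mu> x)) \<le> (\<Sum>\<mu>\<in>A. norm (d \<mu>) * (if x = \<mu> then 0 else norm (f \<mu> x)))"
        by (rule sum_norm_le) (auto simp: norm_mult)
      finally show ?thesis by (auto split: if_splits)
    qed
    have "(\<Sum>x\<in>B. norm (d x - g x)) \<le> (\<Sum>x\<in>B. if x \<in> A then 0 else norm (d x))
        + (\<Sum>x\<in>B. \<Sum>\<mu>\<in>A. norm (d \<mu>) * (if x = \<mu> then 0 else norm (f \<mu> x)))"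
      unfolding sum.distrib[symmetric] using pt by (rule sum_mono)
    also have "(\<Sum>x\<in>B. if x \<in> A then 0 else norm (d x)) = (\<Sum>x\<in>B - A. norm (d x))"
      using B(1) by (intro sum.mono_neutral_cong_right) auto
    also have "\<dots> \<le> s / 4" using A(3) B unfolding l1_bound_def by (meson Diff_mono finite_Diff order_refl)
    \<comment> \<open>After the swap each inner sum is the off-diagonal mass of a single
      \<open>f \<mu>\<close>, at most \<open>1/2\<close>.\<close>
    also have "(\<Sum>x\<in>B. \<Sum>\<mu>\<in>A. norm (d \<mu>) * (if x = \<mu> then 0 else norm (f \<mu> x)))
        = (\<Sum>\<mu>\<in>A. norm (d \<mu>) * (\<Sum>x\<in>B. if x = \<mu> then 0 else norm (f \<mu> x)))"
      by (subst sum.swap) (simp add: sum_distrib_left)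
    also have "\<dots> \<le> (\<Sum>\<mu>\<in>A. norm (d \<mu>) * (1 / 2))"
    proof (intro sum_mono mult_left_mono norm_ge_zero)
      fix \<mu> assume \<mu>: "\<mu> \<in> A"
      have "(\<Sum>x\<in>B. if x = \<mu> then 0 else norm (f \<mu> x)) = (\<Sum>x\<in>B - {\<mu>}. norm (f \<mu> x))"
        using B(1) by (intro sum.mono_neutral_cong_right) auto
      also have "\<dots> \<le> 1 / 2" using \<mu> A(2) B by (intro f(3)) auto
      finally show "(\<Sum>x\<in>B. if x = \<mu> then 0 else norm (f \<mu> x)) \<le> 1 / 2" .
    qed
    also have "\<dots> \<le> s * (1 / 2)" unfolding sum_distrib_right[symmetric] using A_sum by simp
    finally show ?thesis by simp
  qed
  ultimately show ?thesis unfolding l1_bound_def by blast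
qed

text \<open>The correction step is applied repeatedly to the remaining error. Errors and density
  bounds both shrink like \<open>(3/4)^k\<close>, so the corrections sum to an exact interpolant
  with spectrum still in \<open>K\<close>.\<close>

lemma interpolation_of_l1_data:
  assumes K: "bounded K" and C: "0 \<le> C"
    and f: "\<And>\<mu>. \<mu> \<in> \<Lambda> \<Longrightarrow> \<exists>f. spectral_rep K C f \<and> f \<mu> = 1 \<and>
       (\<forall>B. finite B \<longrightarrow> B \<subseteq> \<Lambda> - {\<mu>} \<longrightarrow> (\<Sum>x\<in>B. norm (f x)) \<le> 1 / 2)"
    and d: "l1_bound \<Lambda> d 1"
  shows "\<exists>D g. spectral_rep K D g \<and> (\<forall>x\<in>\<Lambda>. g x = d x)"
proof -
  \<comment> \<open>The hypotheses sit under the existential so that choice yields a total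
    \<open>G\<close>, usable in the recursion before its bounds are proved.\<close>
  have "\<exists>g. l1_bound \<Lambda> d s \<longrightarrow> s > 0 \<longrightarrow> spectral_rep K (C * s) g \<and> l1_bound \<Lambda> (\<lambda>x. d x - g x) (3 / 4 * s)" for d s
    using interpolation_step[OF K C f] by blast
  then obtain G where G: "\<And>d s. l1_bound \<Lambda> d s \<Longrightarrow> s > 0 \<Longrightarrow> spectral_rep K (C * s) (G d s)"
    "\<And>d s. l1_bound \<Lambda> d s \<Longrightarrow> s > 0 \<Longrightarrow> l1_bound \<Lambda> (\<lambda>x. d x - G d s x) (3 / 4 * s)"
    by metis
  \<comment> \<open>\<open>r k\<close> is the error left after \<open>k\<close> corrections.\<close>
  define r where "r = rec_nat d (\<lambda>k e x. e x - G e ((3 / 4) ^ k) x)"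
  have r0: "r 0 = d" and rS: "r (Suc k) = (\<lambda>x. r k x - G (r k) ((3 / 4) ^ k) x)" for k
    by (simp_all add: r_def)
  have r: "l1_bound \<Lambda> (r k) ((3 / 4) ^ k)" for k
  proof (induction k)
    case (Suc k)
    then show ?case using G(2)[of "r k" "(3 / 4) ^ k"] by (simp add: rS)
  qed (use d r0 in simp)
  define g where "g = (\<lambda>k. G (r k) ((3 / 4) ^ k))"
  have g: "spectral_rep K (C * (3 / 4) ^ k) (g k)" for k unfolding g_def using r by (intro G(1)) auto
  have "spectral_rep K (\<Sum>k. C * (3 / 4) ^ k) (\<lambda>x. \<Sum>k. g k x)"
    by (rule spectral_rep_suminf[OF K g]) (auto intro!: summable_mult summable_geometric)
  moreover have "(\<Sum>k. g k x) = d x" if x: "x \<in> \<Lambda>" for x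
  proof -
    have "norm (r n x) \<le> (3 / 4) ^ n" for n
      using r[of n] x unfolding l1_bound_def by (auto dest!: spec[of _ "{x}"])
    moreover have "(\<lambda>n. (3 / 4 :: real) ^ n) \<longlonglongrightarrow> 0" by (rule LIMSEQ_realpow_zero) auto
    ultimately have "(\<lambda>n. r n x) \<longlonglongrightarrow> 0" by (intro Lim_null_comparison[of "\<lambda>n. r n x"]) auto
    then have "(\<lambda>n. d x - r n x) \<longlonglongrightarrow> d x - 0" by (intro tendsto_intros)
    \<comment> \<open>Telescoping: the first \<open>n\<close> corrections account for everything but
      the error \<open>r n\<close>.\<close>
    moreover have "(\<Sum>k<n. g k x) = d x - r n x" for n
      by (induction n) (simp_all add: r0 rS g_def)
    ultimately have "(\<lambda>k. g k x) sums d x" by (simp add: sums_def)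
    then show ?thesis by (rule sums_unique[symmetric])
  qed
  ultimately show ?thesis by blast
qed

section \<open>Adjoining a point and conclusion\<close>

text \<open>A shift of a point of \<open>\<Lambda>\<close> by half the separation stays at least
  that half away from all of \<open>\<Lambda>\<close>.\<close>

lemma uniformly_discrete_insert_point:
  assumes "uniformly_discrete \<Lambda>"
  obtains \<delta> x0 where "\<delta> > 0" "x0 \<notin> \<Lambda>" "separated \<delta> (insert x0 \<Lambda>)"
proof (cases "\<Lambda> = {}")
  case True
  then show ?thesis using that[of 1 0] by (simp add: separated_def)
next
  case False
  then obtain l where l: "l \<in> \<Lambda>" by blast
  obtain \<delta> where \<delta>: "\<delta> > 0" "\<And>x y. x \<in> \<Lambda> \<Longrightarrow> y \<in> \<Lambda> \<Longrightarrow> x \<noteq> y \<Longrightarrow> \<delta> \<le> \<bar>x - y\<bar>"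
    using assms unfolding uniformly_discrete_def by blast
  have far: "\<delta> / 2 \<le> \<bar>(l + \<delta> / 2) - y\<bar>" if "y \<in> \<Lambda>" for y
    using \<delta>(1) \<delta>(2)[OF l that] by (cases "y = l") (auto simp: abs_if split: if_splits)
  have "l + \<delta> / 2 \<notin> \<Lambda>" using far \<delta>(1) by force
  moreover have "separated (\<delta> / 2) (insert (l + \<delta> / 2) \<Lambda>)"
    unfolding separated_def
  proof (intro ballI impI)
    fix x y assume xy: "x \<in> insert (l + \<delta> / 2) \<Lambda>" "y \<in> insert (l + \<delta> / 2) \<Lambda>" "x \<noteq> y"
    then consider "x \<in> \<Lambda>" "y \<in> \<Lambda>" | "x = l + \<delta> / 2" "y \<in> \<Lambda>" | "y = l + \<delta> / 2" "x \<in> \<Lambda>" by blast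
    then show "\<delta> / 2 \<le> \<bar>x - y\<bar>"
    proof cases
      case 1
      then show ?thesis using \<delta> xy(3) by (smt (verit) field_sum_of_halves)
    qed (use far in \<open>auto simp: abs_minus_commute\<close>)
  qed
  ultimately show ?thesis using that[of "\<delta> / 2"] \<delta>(1) by auto
qed

theorem theorem7:
  fixes \<gamma> :: "nat \<Rightarrow> real" and S :: "real set"
  assumes xi: "\<And>j. \<gamma> (Suc j) - \<gamma> j - 1 \<in> {2..3}"
    and S_def: "S = (\<Union>j. {\<gamma> j .. \<gamma> j + 1})"
    and C: "property_C (range \<gamma>)"
  shows "\<forall>\<alpha>::real. \<alpha> > 1/2 \<longrightarrow>
           (\<forall>\<Lambda>::real set. uniformly_discrete \<Lambda> \<longrightarrow> \<not> uniqueness_set \<Lambda> (W_space \<alpha> S))"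
proof (intro allI impI notI)
  fix \<alpha> :: real and \<Lambda> :: "real set"
  assume \<alpha>: "\<alpha> > 1/2" and ud: "uniformly_discrete \<Lambda>" and uniq: "uniqueness_set \<Lambda> (W_space \<alpha> S)"
  \<comment> \<open>\<open>\<delta>\<close> separates the enlarged set, since interpolation takes
    place there.\<close>
  obtain \<delta> x0 where x0: "\<delta> > 0" "x0 \<notin> \<Lambda>" "separated \<delta> (insert x0 \<Lambda>)"
    using uniformly_discrete_insert_point[OF ud] by blast
  obtain K where K: "bounded K" "K \<subseteq> (\<Union>g\<in>range \<gamma>. {g..g + 1})"
    "\<And>\<Lambda> \<mu>. separated \<delta> \<Lambda> \<Longrightarrow> \<mu> \<in> \<Lambda> \<Longrightarrow> \<exists>f. spectral_rep K 2 f \<and> f \<mu> = 1 \<and>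
       (\<forall>B. finite B \<longrightarrow> B \<subseteq> \<Lambda> - {\<mu>} \<longrightarrow> (\<Sum>x\<in>B. norm (f x)) \<le> 1 / 2)"
    using exists_localized_function[OF C x0(1)] by blast
  define d :: "real \<Rightarrow> complex" where "d = (\<lambda>x. if x = x0 then 1 else 0)"
  have "(\<Sum>x\<in>B. norm (d x)) \<le> 1" if "finite B" for B
  proof -
    have "(\<Sum>x\<in>B. norm (d x)) = (\<Sum>x\<in>B. if x = x0 then 1 else 0)"
      by (intro sum.cong) (auto simp: d_def)
    then show ?thesis using that by simp
  qed
  then have d: "l1_bound (insert x0 \<Lambda>) d 1" by (simp add: l1_bound_def)
  obtain D f where f: "spectral_rep K D f" "\<forall>x\<in>insert x0 \<Lambda>. f x = d x"
    using interpolation_of_l1_data[OF K(1) _ K(3)[OF x0(3)] d] by auto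
  have "f \<in> W_space \<alpha> S"
    using K(2) \<alpha> S_def by (intro spectral_rep_in_W_space[OF K(1) _ f(1)]) auto
  moreover have "\<forall>x\<in>\<Lambda>. f x = 0" using f(2) x0(2) by (auto simp: d_def)
  ultimately have "f = (\<lambda>_. 0)" using uniq unfolding uniqueness_set_def by blast
  then show False using f(2) by (simp add: d_def)
qed

end
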